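(* Assume that $(V_h)$, $\gamma$, $L$ and $(L_h)$ satisfy Assumptions 1, 2, 3, 4 and 6 listed in the context, and that the growth exponent $\alpha$ of the eigenvalues satisfies $$\max\left(\frac{1}{2\beta},\frac{1}{2a}\right)\le\alpha\le\min\left(\frac{2s}{\tilde d q},\frac{r}{\tilde d q}\right),$$ where the left-hand side is understood as $+\infty$ if $a=0$. Then there exists a constant $M$ independent of $h$ such that, for every mesh size $h\in\mathcal{H}\cap\,]0,h_0[$ small enough in the sense of Assumption 5 of the context, the generalized random field $Z=\gamma(L)\mathcal{W}$ and its finite element approximation $Z_h=\gamma(L_h)\mathcal{W}_h$ satisfy $$\|Z-Z_h\|_{L^2(\Omega;H)}\le M\,h^{\min\left(s-\tilde d q\alpha/2,\ r-\tilde d q\alpha,\ \tilde d(\alpha\beta-1/2),\ \tilde d(\alpha a-1/2)\right)} .$$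
   Context: Let $d\ge1$ and let $\mathcal{D}$ be either a bounded (convex and polygonal) domain of $\mathbb{R}^d$ or a compact $d$-dimensional smooth Riemannian manifold; $H=L^2(\mathcal{D})$ with inner product $(\cdot,\cdot)_H$ and norm $\|\cdot\|_H$; $\mathbb{N}=\{1,2,\dots\}$. Let $L$ be a densely defined, self-adjoint, positive semi-definite linear differential operator of second order with domain $\mathscr{D}(L)\subset H$ (Dirichlet boundary conditions), diagonalizable on an orthonormal basis $\{e_j\}_{j\in\mathbb{N}}$ of $H$ with eigenvalues $0\le\lambda_1\le\lambda_2\le\dots$, $\lambda_j\to+\infty$. Let $(V_h)_{h\in\mathcal{H}}$, $\mathcal{H}\subset\,]0,1]$, be a family of finite element spaces indexed by the mesh size $h$: $V_h\subset\mathscr{D}(L)\subset H$ is a finite-dimensional space of dimension $N_h$. Let $\{f_{j,h}\}_{1\le j\le N_h}$ be an orthonormal basis of $V_h$ for $(\cdot,\cdot)_H$ and let $L_h:V_h\to V_h$, $L_h\psi=\sum_{j=1}^{N_h}(L\psi,f_{j,h})_Hf_{j,h}$. Let $0\le\lambda_{1,h}\le\dots\le\lambda_{N_h,h}$ be the eigenvalues of $L_h$ in non-decreasing order, with associated orthonormal eigenfunctions $e_{1,h},\dots,e_{N_h,h}$. Let $\gamma:\mathbb{R}_+\to\mathbb{R}$ with $\sum_{j\in\mathbb{N}}\gamma(\lambda_j)^2<\infty$ (the standing assumption under which $\gamma(L)\mathcal{W}$ is defined). Let $(\tilde\xi_j)_{j\in\mathbb{N}}$ be independent standard normal random variables on a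 complete probability space $(\Omega,\mathcal{A},\mathbb{P})$, and define $$Z=\gamma(L)\mathcal{W}=\sum_{j\in\mathbb{N}}\gamma(\lambda_j)\tilde\xi_je_j,\qquad Z_h=\gamma(L_h)\mathcal{W}_h=\sum_{j=1}^{N_h}\gamma(\lambda_{j,h})\tilde\xi_je_{j,h},$$ with the same variables $\tilde\xi_j$ in both. $L^2(\Omega;H)$ is the space of $H$-valued random variables with norm $\|f\|_{L^2(\Omega;H)}=\sqrt{\mathbb{E}[\|f\|_H^2]}$. Assumptions: Assumption 1 (growth of the eigenvalues of $L$). There exist constants $\alpha>0$, $c_\lambda>0$, $C_\lambda>0$ such that for all $j\in\mathbb{N}$: $\lambda_j>0\Rightarrow c_\lambda j^\alpha\le\lambda_j\le C_\lambda j^\alpha$. Assumption 2 (derivative of $\gamma$). $\gamma$ is differentiable on $\mathbb{R}_+$ and there exist $C_{\mathrm{Deriv}}>0$ and $a\ge0$ such that $|\gamma'(x)|\le C_{\mathrm{Deriv}}\,x^{-a}$ for all $x>0$. Assumption 3 (asymptotic behavior of $\gamma$). There exist $\beta>0$, $C_\gamma>0$, $R_\gamma>0$ such that $\lambda\ge R_\gamma\Rightarrow|\gamma(\lambda)|\le C_\gamma\lambda^{-\beta}$. Assumption 4 (dimension of the finite element space). There exist $\tilde d>0$, $C_{\mathrm{FES}}>0$ such that $N_h=\dim(V_h)=C_{\mathrm{FES}}h^{-\tilde d}$ for all $h\in\mathcal{H}$. Assumption 5 (mesh size). $h\le\left(\frac{1}{C_{\mathrm{FES}}}\left\lceil\left(\frac{R_\gamma}{c_\lambda}\right)^{1/\alpha}\right\rceil\right)^{-1/\tilde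 d}$. Assumption 6 (eigenvalues and eigenvectors of $L_h$). There exist constants $C_1,C_2>0$, $h_0\in\,]0,1[$ and exponents $r,s>0$, $q>1$ such that for all $h\in\mathcal{H}\cap\,]0,h_0[$ and all $1\le j\le N_h$: $0\le\lambda_{j,h}-\lambda_j\le C_1h^r\lambda_j^q$ and $\|e_{j,h}-e_j\|_H^2\le C_2h^{2s}\lambda_j^q$. *)

theory Defs
  imports "HOL-Probability.Probability"
begin

section \<open>Square-integrable functions and abstract realisations of $L^2$\<close>

definition sq_integrable :: "'x measure \<Rightarrow> ('x \<Rightarrow> 'b::{real_normed_vector, second_countable_topology}) set"
  where "sq_integrable M = {f \<in> borel_measurable M. integrable M (\<lambda>x. (norm (f x))\<^sup>2)}"

text \<open>Only meaningful on \<^const>\<open>sq_integrable\<close>: the Bochner integral of a non-integrable function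
  is \<open>0\<close>, so membership has to be stated alongside.\<close>

definition sq_norm :: "'x measure \<Rightarrow> ('x \<Rightarrow> 'b::{real_normed_vector, second_countable_topology}) \<Rightarrow> real"
  where "sq_norm M f = sqrt (\<integral>x. (norm (f x))\<^sup>2 \<partial>M)"

text \<open>The Hilbert space $L^2(\mu)$ depends on \<open>\<mu>\<close> and hence is not a type constructor. It is given
  as a type \<open>'h\<close> together with the map \<open>cls\<close> that sends a square-integrable function to its
  almost-everywhere equivalence class; the inner product and norm of \<open>'h\<close> are those of
  $L^2(\mu)$.\<close>

definition L2_realisation ::
    "'p measure \<Rightarrow> (('p \<Rightarrow> real) \<Rightarrow> 'h::{real_inner, banach, second_countable_topology}) \<Rightarrow> bool"
  where "L2_realisation \<mu> cls \<longleftrightarrow>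
    (\<forall>f \<in> sq_integrable \<mu>. \<forall>g \<in> sq_integrable \<mu>. cls (\<lambda>x. f x + g x) = cls f + cls g) \<and>
    (\<forall>f \<in> sq_integrable \<mu>. \<forall>c. cls (\<lambda>x. c * f x) = c *\<^sub>R cls f) \<and>
    (\<forall>f \<in> sq_integrable \<mu>. \<forall>g \<in> sq_integrable \<mu>. cls f \<bullet> cls g = (\<integral>x. f x * g x \<partial>\<mu>)) \<and>
    cls ` sq_integrable \<mu> = UNIV"

section \<open>Riemannian manifolds, possibly with boundary\<close>

text \<open>All derivatives are taken within \<open>S\<close>. The sets \<open>S\<close> used below are open in $\mathbb{R}^n$ or
  relatively open in a closed half-space, so these derivatives are unique. On such sets
  \<open>smooth_on\<close> is the usual $C^\infty$, up to the boundary in the half-space case.\<close>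

definition partial :: "(real^'n) set \<Rightarrow> 'n \<Rightarrow> (real^'n \<Rightarrow> 'b::real_normed_vector) \<Rightarrow> real^'n \<Rightarrow> 'b"
  where "partial S i f = (\<lambda>y. frechet_derivative f (at y within S) (axis i 1))"

definition smooth_on :: "(real^'n) set \<Rightarrow> (real^'n \<Rightarrow> 'b::real_normed_vector) \<Rightarrow> bool"
  where "smooth_on S f \<longleftrightarrow> (\<forall>is. foldr (partial S) is f differentiable_on S)"

definition model_open :: "(real^'n) set \<Rightarrow> bool"
  where "model_open S \<longleftrightarrow> open S \<or> (\<exists>k. openin (top_of_set {y. 0 \<le> y $ k}) S)"

type_synonym ('p, 'n) chart = "'p set \<times> ('p \<Rightarrow> real^'n)"

definition smooth_atlas :: "'p topology \<Rightarrow> ('p, 'n::finite) chart set \<Rightarrow> bool"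
  where "smooth_atlas X A \<longleftrightarrow>
    (\<Union>(U, \<phi>)\<in>A. U) = topspace X \<and>
    (\<forall>(U, \<phi>)\<in>A. openin X U \<and> model_open (\<phi> ` U) \<and>
       homeomorphic_map (subtopology X U) (top_of_set (\<phi> ` U)) \<phi>) \<and>
    (\<forall>(U, \<phi>)\<in>A. \<forall>(V, \<psi>)\<in>A. smooth_on (\<phi> ` (U \<inter> V)) (\<psi> \<circ> inv_into U \<phi>))"

text \<open>\<open>G c y\<close> is the Gram matrix $(g_{ij})$ of the metric in the chart \<open>c\<close> at the coordinates
  \<open>y\<close>.\<close>

definition riemannian_metric ::
    "('p, 'n::finite) chart set \<Rightarrow> (('p, 'n) chart \<Rightarrow> real^'n \<Rightarrow> real^'n^'n) \<Rightarrow> bool"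
  where "riemannian_metric A G \<longleftrightarrow>
    (\<forall>(U, \<phi>)\<in>A. smooth_on (\<phi> ` U) (G (U, \<phi>)) \<and>
       (\<forall>y \<in> \<phi> ` U. transpose (G (U, \<phi>) y) = G (U, \<phi>) y \<and>
          (\<forall>v. v \<noteq> 0 \<longrightarrow> 0 < v \<bullet> (G (U, \<phi>) y *v v)))) \<and>
    (\<forall>(U, \<phi>)\<in>A. \<forall>(V, \<psi>)\<in>A. \<forall>y \<in> \<phi> ` (U \<inter> V).
       let \<tau> = \<psi> \<circ> inv_into U \<phi>; J = jacobian \<tau> (at y within \<phi> ` (U \<inter> V))
       in G (U, \<phi>) y = transpose J ** G (V, \<psi>) (\<tau> y) ** J)"

definition compact_riemannian_manifold ::
    "'p topology \<Rightarrow> ('p, 'n::finite) chart set \<Rightarrow> (('p, 'n) chart \<Rightarrow> real^'n \<Rightarrow> real^'n^'n) \<Rightarrow> bool"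
  where "compact_riemannian_manifold X A G \<longleftrightarrow>
    compact_space X \<and> Hausdorff_space X \<and> second_countable X \<and>
    smooth_atlas X A \<and> riemannian_metric A G"

definition riemannian_volume ::
    "'p topology \<Rightarrow> ('p, 'n::finite) chart set \<Rightarrow> (('p, 'n) chart \<Rightarrow> real^'n \<Rightarrow> real^'n^'n) \<Rightarrow>
     'p measure \<Rightarrow> bool"
  where "riemannian_volume X A G \<mu> \<longleftrightarrow>
    space \<mu> = topspace X \<and> sets \<mu> = sigma_sets (topspace X) {U. openin X U} \<and>
    (\<forall>(U, \<phi>)\<in>A. \<forall>B \<in> sets \<mu>. B \<subseteq> U \<longrightarrow>
       emeasure \<mu> B = (\<integral>\<^sup>+ y \<in> \<phi> ` B. ennreal (sqrt (det (G (U, \<phi>) y))) \<partial>lborel))"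

definition manifold_interior :: "('p, 'n::finite) chart set \<Rightarrow> 'p set"
  where "manifold_interior A = {p. \<exists>(U, \<phi>)\<in>A. p \<in> U \<and> \<phi> p \<in> interior (\<phi> ` U)}"

definition test_function :: "'p topology \<Rightarrow> ('p, 'n::finite) chart set \<Rightarrow> ('p \<Rightarrow> real) \<Rightarrow> bool"
  where "test_function X A u \<longleftrightarrow>
    (\<forall>(U, \<phi>)\<in>A. smooth_on (\<phi> ` U) (u \<circ> inv_into U \<phi>)) \<and>
    (\<exists>K. compactin X K \<and> K \<subseteq> manifold_interior A \<and> (\<forall>p \<in> topspace X - K. u p = 0))"

text \<open>$|\nabla u|_g^2 = g^{ij}\,\partial_i u\,\partial_j u$. The value does not depend on the chart.\<close>

definition grad_sq ::
    "('p, 'n::finite) chart set \<Rightarrow> (('p, 'n) chart \<Rightarrow> real^'n \<Rightarrow> real^'n^'n) \<Rightarrow>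
     ('p \<Rightarrow> real) \<Rightarrow> 'p \<Rightarrow> real"
  where "grad_sq A G u p =
    (let c = (SOME c. c \<in> A \<and> p \<in> fst c); U = fst c; \<phi> = snd c;
         v = (\<chi> i. partial (\<phi> ` U) i (u \<circ> inv_into U \<phi>) (\<phi> p))
     in v \<bullet> (matrix_inv (G c (\<phi> p)) *v v))"

text \<open>$H^1_0$ as the completion of the test functions for the $H^1$ norm.\<close>

definition H10 ::
    "'p topology \<Rightarrow> ('p, 'n::finite) chart set \<Rightarrow> (('p, 'n) chart \<Rightarrow> real^'n \<Rightarrow> real^'n^'n) \<Rightarrow>
     'p measure \<Rightarrow> (('p \<Rightarrow> real) \<Rightarrow> 'h::{real_inner, banach, second_countable_topology}) \<Rightarrow> 'h set"
  where "H10 X A G \<mu> cls = {u. \<exists>F. (\<forall>n. test_function X A (F n)) \<and> (\<lambda>n. cls (F n)) \<longlonglongrightarrow> u \<and>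
    (\<forall>\<epsilon>>0. \<exists>n0::nat. \<forall>m\<ge>n0. \<forall>n\<ge>n0. (\<integral>p. grad_sq A G (\<lambda>x. F m x - F n x) p \<partial>\<mu>) < \<epsilon>)}"

section \<open>Linear operators\<close>

text \<open>In chart coordinates the operator reads
  $\sum_{i,j} a_{ij}\partial_i\partial_j + \sum_i b_i\partial_i + c_0$ on test functions; for
  a self-adjoint operator this is the same as acting by this expression in the sense of
  distributions on its whole domain. The second-order part does not vanish identically. No
  regularity or ellipticity of the coefficients is imposed.\<close>

definition second_order_operator ::
    "'p topology \<Rightarrow> ('p, 'n::finite) chart set \<Rightarrow> 'p measure \<Rightarrow>
     (('p \<Rightarrow> real) \<Rightarrow> 'h::{real_inner, banach, second_countable_topology}) \<Rightarrow>
     'h set \<Rightarrow> ('h \<Rightarrow> 'h) \<Rightarrow> bool"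
  where "second_order_operator X A \<mu> cls domL L \<longleftrightarrow>
    (\<exists>(a :: ('p, 'n) chart \<Rightarrow> real^'n \<Rightarrow> real^'n^'n) (b :: ('p, 'n) chart \<Rightarrow> real^'n \<Rightarrow> real^'n)
      (c0 :: ('p, 'n) chart \<Rightarrow> real^'n \<Rightarrow> real).
      (\<forall>c\<in>A. \<forall>y. transpose (a c y) = a c y) \<and>
      (\<exists>c\<in>A. \<not> (AE p in \<mu>. p \<in> fst c \<longrightarrow> a c (snd c p) = 0)) \<and>
      (\<forall>u. test_function X A u \<longrightarrow> cls u \<in> domL \<and>
        (\<forall>w \<in> sq_integrable \<mu>. cls w = L (cls u) \<longrightarrow>
          (\<forall>(U, \<phi>)\<in>A. AE p in \<mu>. p \<in> U \<longrightarrow>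
            (let S = \<phi> ` U; f = u \<circ> inv_into U \<phi>; y = \<phi> p in
             w p = (\<Sum>i\<in>UNIV. \<Sum>j\<in>UNIV. a (U, \<phi>) y $ i $ j * partial S i (partial S j f) y)
                 + (\<Sum>i\<in>UNIV. b (U, \<phi>) y $ i * partial S i f y) + c0 (U, \<phi>) y * f y)))))"

text \<open>The last conjunct says that the graph of the adjoint is the graph of \<open>L\<close>.\<close>

definition self_adjoint_operator :: "'h::real_inner set \<Rightarrow> ('h \<Rightarrow> 'h) \<Rightarrow> bool"
  where "self_adjoint_operator domL L \<longleftrightarrow>
    subspace domL \<and> closure domL = UNIV \<and>
    (\<forall>u\<in>domL. \<forall>v\<in>domL. L (u + v) = L u + L v) \<and>
    (\<forall>u\<in>domL. \<forall>c. L (c *\<^sub>R u) = c *\<^sub>R L u) \<and>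
    {(u, w). \<forall>v\<in>domL. L v \<bullet> u = v \<bullet> w} = {(u, L u) | u. u \<in> domL}"

definition positive_semidefinite_operator :: "'h::real_inner set \<Rightarrow> ('h \<Rightarrow> 'h) \<Rightarrow> bool"
  where "positive_semidefinite_operator domL L \<longleftrightarrow> (\<forall>u\<in>domL. 0 \<le> L u \<bullet> u)"

section \<open>The two admissible settings\<close>

text \<open>A Euclidean domain carries the identity chart and the standard metric.\<close>

definition polygonal_domain_setting ::
    "(real^'n::finite) set \<Rightarrow>
     ((real^'n \<Rightarrow> real) \<Rightarrow> 'h::{real_inner, banach, second_countable_topology}) \<Rightarrow>
     'h set \<Rightarrow> ('h \<Rightarrow> 'h) \<Rightarrow> bool"
  where "polygonal_domain_setting D cls domL L \<longleftrightarrow>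
    open D \<and> D \<noteq> {} \<and> bounded D \<and> convex D \<and> polytope (closure D) \<and>
    L2_realisation (lebesgue_on D) cls \<and>
    second_order_operator (top_of_set D) {(D, \<lambda>x. x)} (lebesgue_on D) cls domL L \<and>
    domL \<subseteq> H10 (top_of_set D) {(D, \<lambda>x. x)} (\<lambda>_ _. mat 1) (lebesgue_on D) cls"

text \<open>Without boundary the Dirichlet condition is void.\<close>

definition manifold_setting ::
    "'p topology \<Rightarrow> ('p, 'n::finite) chart set \<Rightarrow> (('p, 'n) chart \<Rightarrow> real^'n \<Rightarrow> real^'n^'n) \<Rightarrow>
     'p measure \<Rightarrow> (('p \<Rightarrow> real) \<Rightarrow> 'h::{real_inner, banach, second_countable_topology}) \<Rightarrow>
     'h set \<Rightarrow> ('h \<Rightarrow> 'h) \<Rightarrow> bool"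
  where "manifold_setting X A G \<mu> cls domL L \<longleftrightarrow>
    compact_riemannian_manifold X A G \<and> riemannian_volume X A G \<mu> \<and>
    L2_realisation \<mu> cls \<and>
    second_order_operator X A \<mu> cls domL L \<and>
    (manifold_interior A \<noteq> topspace X \<longrightarrow> domL \<subseteq> H10 X A G \<mu> cls)"

section \<open>Orthonormal families and the Galerkin operator\<close>

text \<open>Sequences are indexed from \<open>1\<close>; the value at index \<open>0\<close> is irrelevant.\<close>

definition orthonormal_family :: "nat set \<Rightarrow> (nat \<Rightarrow> 'h::real_inner) \<Rightarrow> bool"
  where "orthonormal_family J b \<longleftrightarrow> (\<forall>i\<in>J. \<forall>j\<in>J. b i \<bullet> b j = (if i = j then 1 else 0))"

definition hilbert_basis :: "(nat \<Rightarrow> 'h::real_inner) \<Rightarrow> bool"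
  where "hilbert_basis b \<longleftrightarrow> orthonormal_family {1..} b \<and> closure (span (b ` {1..})) = UNIV"

definition orthonormal_basis_of :: "'h::real_inner set \<Rightarrow> nat \<Rightarrow> (nat \<Rightarrow> 'h) \<Rightarrow> bool"
  where "orthonormal_basis_of V N b \<longleftrightarrow> orthonormal_family {1..N} b \<and> span (b ` {1..N}) = V"

definition galerkin_operator :: "nat \<Rightarrow> (nat \<Rightarrow> 'h::real_inner) \<Rightarrow> ('h \<Rightarrow> 'h) \<Rightarrow> 'h \<Rightarrow> 'h"
  where "galerkin_operator N f L \<psi> = (\<Sum>j=1..N. (L \<psi> \<bullet> f j) *\<^sub>R f j)"

section \<open>Generalized random fields\<close>

definition field_partial_sum ::
    "(real \<Rightarrow> real) \<Rightarrow> (nat \<Rightarrow> real) \<Rightarrow> (nat \<Rightarrow> 'h::real_vector) \<Rightarrow> (nat \<Rightarrow> 'w \<Rightarrow> real) \<Rightarrow>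
     nat \<Rightarrow> 'w \<Rightarrow> 'h"
  where "field_partial_sum \<gamma> lam e \<xi> n = (\<lambda>\<omega>. \<Sum>j=1..n. (\<gamma> (lam j) * \<xi> j \<omega>) *\<^sub>R e j)"

text \<open>\<open>Z\<close> is (a version of) the sum of $\sum_{j\ge 1} \gamma(\lambda_j)\,\xi_j\,e_j$ in
  $L^2(\Omega; H)$.\<close>

definition is_generalized_field ::
    "'w measure \<Rightarrow> (real \<Rightarrow> real) \<Rightarrow> (nat \<Rightarrow> real) \<Rightarrow>
     (nat \<Rightarrow> 'h::{real_inner, banach, second_countable_topology}) \<Rightarrow> (nat \<Rightarrow> 'w \<Rightarrow> real) \<Rightarrow>
     ('w \<Rightarrow> 'h) \<Rightarrow> bool"
  where "is_generalized_field P \<gamma> lam e \<xi> Z \<longleftrightarrow>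
    Z \<in> sq_integrable P \<and>
    (\<forall>n. field_partial_sum \<gamma> lam e \<xi> n \<in> sq_integrable P) \<and>
    (\<lambda>n. sq_norm P (\<lambda>\<omega>. Z \<omega> - field_partial_sum \<gamma> lam e \<xi> n \<omega>)) \<longlonglongrightarrow> 0"

end

theory Submission
  imports Defs
begin

text \<open>Put \<open>N = dim (V h)\<close>, so that \<open>N\<close> is a constant multiple of \<open>h powr (- dt)\<close>. Both fields are driven by
  the same noise, and the variables \<open>\<xi> j\<close> are orthonormal in \<open>L\<^sup>2(\<Omega>)\<close>. Therefore the mean square
  of any finite sum \<open>\<Sum>j. \<xi> j *\<^sub>R d j\<close> is \<open>\<Sum>j. (norm (d j))\<^sup>2\<close> (\<open>sq_norm_noise_sum\<close>), and the
  squared error is, up to a constant, bounded by three deterministic sums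
  (\<open>field_discretisation_error\<close>).

  \<^item> Truncation, \<open>\<Sum>j>N. (\<gamma> (lam j))\<^sup>2\<close>. The decay of \<open>\<gamma>\<close> and the growth of the eigenvalues make
    the terms at most of order \<open>j powr (- 2 * \<alpha> * \<beta>)\<close>, hence the tail at most of order
    \<open>N powr (1 - 2 * \<alpha> * \<beta>)\<close> (\<open>gamma_tail_bound\<close>). If \<open>2 * \<alpha> * \<beta> = 1\<close>, the assumed convergence
    of the series gives the required boundedness.

  \<^item> Eigenvectors, \<open>\<Sum>j\<le>N. (\<gamma> (lam j))\<^sup>2 * (norm (e j - eh h j))\<^sup>2\<close>. The weights have a finite total
    and the squared distances are of order at most \<open>h powr (2 * s) * lam N powr q\<close>, that is
    \<open>h powr (2 * s) * N powr (\<alpha> * q)\<close> (\<open>eigenvector_error_sum\<close>).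

  \<^item> Eigenvalues, \<open>\<Sum>j\<le>N. (\<gamma> (lam j) - \<gamma> (lamh h j))\<^sup>2\<close>. The mean value theorem bounds the
    differences by multiples of \<open>h powr r * lam j powr (q - a)\<close>; as \<open>2 * \<alpha> * a \<ge> 1\<close>, the sum of the squares is
    at most of order \<open>h powr (2 * r) * N powr (2 * \<alpha> * q)\<close> (\<open>eigenvalue_error_sum\<close>).

  In terms of \<open>h\<close> these bounds are constant multiples of \<open>h\<close> to the powers \<open>2 * (dt * (\<alpha> * \<beta> - 1 / 2))\<close>,
  \<open>2 * (s - dt * q * \<alpha> / 2)\<close> and \<open>2 * (r - dt * q * \<alpha>)\<close>. Since \<open>h \<le> 1\<close>, each is at most \<open>h\<close> to
  twice the smallest exponent, and the square root gives the rate.\<close>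

section \<open>Mean-square estimates\<close>

lemma sq_norm_squared: "(sq_norm M f)\<^sup>2 = (\<integral>x. (norm (f x))\<^sup>2 \<partial>M)"
  unfolding sq_norm_def by simp

text \<open>Only the order of the error matters, not the constant. So this inequality can replace the
  triangle inequality of \<open>L\<^sup>2\<close> in all that follows, and the contributions to the error can be
  added at the level of squares.\<close>

lemma norm_add_squared_le: "(norm (x + y))\<^sup>2 \<le> 2 * (norm x)\<^sup>2 + 2 * (norm y)\<^sup>2"
  for x y :: "'b::real_normed_vector"
proof -
  have "(norm (x + y))\<^sup>2 \<le> (norm x + norm y)\<^sup>2"
    by (intro power_mono norm_triangle_ineq) simp
  also have "\<dots> \<le> 2 * (norm x)\<^sup>2 + 2 * (norm y)\<^sup>2"
    using zero_le_power2[of "norm x - norm y"] by (simp add: power2_sum power2_diff)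
  finally show ?thesis .
qed

lemma sq_integrable_add:
  fixes f g :: "'x \<Rightarrow> 'b::{real_normed_vector, second_countable_topology}"
  assumes "f \<in> sq_integrable M" "g \<in> sq_integrable M"
  shows "(\<lambda>x. f x + g x) \<in> sq_integrable M"
    and "(sq_norm M (\<lambda>x. f x + g x))\<^sup>2 \<le> 2 * (sq_norm M f)\<^sup>2 + 2 * (sq_norm M g)\<^sup>2"
proof -
  have [measurable]: "f \<in> borel_measurable M" "g \<in> borel_measurable M"
    and int: "integrable M (\<lambda>x. (norm (f x))\<^sup>2)" "integrable M (\<lambda>x. (norm (g x))\<^sup>2)"
    using assms by (auto simp: sq_integrable_def)
  have int2: "integrable M (\<lambda>x. 2 * (norm (f x))\<^sup>2 + 2 * (norm (g x))\<^sup>2)"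
    using int by simp
  have int_add: "integrable M (\<lambda>x. (norm (f x + g x))\<^sup>2)"
    by (rule Bochner_Integration.integrable_bound[OF int2])
      (auto intro!: AE_I2 simp: norm_add_squared_le)
  then show "(\<lambda>x. f x + g x) \<in> sq_integrable M"
    by (auto simp: sq_integrable_def)
  have "(\<integral>x. (norm (f x + g x))\<^sup>2 \<partial>M) \<le> (\<integral>x. 2 * (norm (f x))\<^sup>2 + 2 * (norm (g x))\<^sup>2 \<partial>M)"
    by (rule integral_mono[OF int_add int2]) (rule norm_add_squared_le)
  then show "(sq_norm M (\<lambda>x. f x + g x))\<^sup>2 \<le> 2 * (sq_norm M f)\<^sup>2 + 2 * (sq_norm M g)\<^sup>2"
    using int by (simp add: sq_norm_squared)
qed

lemma sq_integrable_uminus: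
  fixes f :: "'x \<Rightarrow> 'b::{real_normed_vector, second_countable_topology}"
  assumes "f \<in> sq_integrable M"
  shows "(\<lambda>x. - f x) \<in> sq_integrable M"
  using assms by (auto simp: sq_integrable_def)

lemma sq_integrable_diff:
  fixes f g :: "'x \<Rightarrow> 'b::{real_normed_vector, second_countable_topology}"
  assumes "f \<in> sq_integrable M" "g \<in> sq_integrable M"
  shows "(\<lambda>x. f x - g x) \<in> sq_integrable M"
  using sq_integrable_add(1)[OF assms(1) sq_integrable_uminus[OF assms(2)]] by simp

section \<open>Sums over the noise\<close>

lemma standard_normal_second_moments:
  assumes "prob_space P" and indep: "prob_space.indep_vars P (\<lambda>_. borel) \<xi> J"
    and normal: "\<And>j. j \<in> J \<Longrightarrow> distributed P lborel (\<xi> j) std_normal_density"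
    and ij: "i \<in> J" "j \<in> J"
  shows "integrable P (\<lambda>\<omega>. \<xi> i \<omega> * \<xi> j \<omega>)"
    and "(\<integral>\<omega>. \<xi> i \<omega> * \<xi> j \<omega> \<partial>P) = (if i = j then 1 else 0)"
proof -
  interpret prob_space P by fact
  have int: "integrable P (\<xi> k)" if "k \<in> J" for k
    using distributed_integrable[OF normal[OF that], of "\<lambda>x. x"] integrable_std_normal_moment[of 1]
    by simp
  have mean: "(\<integral>\<omega>. \<xi> k \<omega> \<partial>P) = 0" if "k \<in> J" for k
    by (rule standard_normal_distributed_expectation[OF normal[OF that]])
  have "integrable P (\<lambda>\<omega>. \<xi> i \<omega> * \<xi> j \<omega>) \<and>
        (\<integral>\<omega>. \<xi> i \<omega> * \<xi> j \<omega> \<partial>P) = (if i = j then 1 else 0)"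
  proof (cases "i = j")
    case True
    have "integrable P (\<lambda>\<omega>. (\<xi> i \<omega>)\<^sup>2)"
      using distributed_integrable[OF normal[OF ij(1)], of "\<lambda>x. x\<^sup>2"] integrable_std_normal_moment[of 2]
      by simp
    moreover have "(\<integral>\<omega>. (\<xi> i \<omega>)\<^sup>2 \<partial>P) = 1"
      using standard_normal_distributed_variance[OF normal[OF ij(1)]] mean[OF ij(1)] by simp
    ultimately show ?thesis
      using True by (simp add: power2_eq_square)
  next
    case False
    have sub: "indep_vars (\<lambda>_. borel) \<xi> {i, j}"
      by (rule indep_vars_subset[OF indep]) (use ij in auto)
    show ?thesis
      using indep_vars_integrable[OF _ sub] indep_vars_lebesgue_integral[OF _ sub] int mean ij False
      by auto
  qed
  then show "integrable P (\<lambda>\<omega>. \<xi> i \<omega> * \<xi> j \<omega>)"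
    and "(\<integral>\<omega>. \<xi> i \<omega> * \<xi> j \<omega> \<partial>P) = (if i = j then 1 else 0)"
    by auto
qed

text \<open>In \<open>L\<^sup>2(\<Omega>)\<close> the variables \<open>\<xi> j\<close> are orthonormal, which makes the cross terms vanish whatever
  the vectors \<open>d j\<close> are. This generality is what the comparison of two bases requires: the
  differences \<open>e j - e' j\<close> of their members are not orthogonal to each other.\<close>

lemma sq_norm_noise_sum:
  fixes d :: "nat \<Rightarrow> 'h::{real_inner, second_countable_topology}"
  assumes P: "prob_space P" and indep: "prob_space.indep_vars P (\<lambda>_. borel) \<xi> J"
    and normal: "\<And>j. j \<in> J \<Longrightarrow> distributed P lborel (\<xi> j) std_normal_density"
    and I: "I \<subseteq> J"
  shows "(\<lambda>\<omega>. \<Sum>j\<in>I. \<xi> j \<omega> *\<^sub>R d j) \<in> sq_integrable P"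
    and "(sq_norm P (\<lambda>\<omega>. \<Sum>j\<in>I. \<xi> j \<omega> *\<^sub>R d j))\<^sup>2 = (\<Sum>j\<in>I. (norm (d j))\<^sup>2)"
proof -
  note moments = standard_normal_second_moments[OF P indep normal]
  have meas[measurable]: "\<xi> j \<in> borel_measurable P" if "j \<in> J" for j
    using distributed_measurable[OF normal[OF that]] by simp
  have norm_eq: "(norm (\<Sum>j\<in>I. \<xi> j \<omega> *\<^sub>R d j))\<^sup>2 = (\<Sum>i\<in>I. \<Sum>j\<in>I. (\<xi> i \<omega> * \<xi> j \<omega>) * (d i \<bullet> d j))" for \<omega>
    unfolding power2_norm_eq_inner inner_sum_left inner_sum_right
    by (intro sum.cong refl) (simp add: inner_commute)
  have int: "integrable P (\<lambda>\<omega>. (\<xi> i \<omega> * \<xi> j \<omega>) * (d i \<bullet> d j))" if "i \<in> I" "j \<in> I" for i j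
    using moments(1)[of i j] that I by auto
  have "integrable P (\<lambda>\<omega>. (norm (\<Sum>j\<in>I. \<xi> j \<omega> *\<^sub>R d j))\<^sup>2)"
    unfolding norm_eq by (intro Bochner_Integration.integrable_sum int)
  moreover have "(\<lambda>\<omega>. \<Sum>j\<in>I. \<xi> j \<omega> *\<^sub>R d j) \<in> borel_measurable P"
    using I by (intro borel_measurable_sum borel_measurable_scaleR meas) auto
  ultimately show "(\<lambda>\<omega>. \<Sum>j\<in>I. \<xi> j \<omega> *\<^sub>R d j) \<in> sq_integrable P"
    by (simp add: sq_integrable_def)
  have "(\<integral>\<omega>. (norm (\<Sum>j\<in>I. \<xi> j \<omega> *\<^sub>R d j))\<^sup>2 \<partial>P) = (\<Sum>i\<in>I. \<Sum>j\<in>I. (if i = j then 1 else 0) * (d i \<bullet> d j))"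
    unfolding norm_eq
  proof (subst Bochner_Integration.integral_sum, (intro Bochner_Integration.integrable_sum int; assumption), intro sum.cong refl)
    fix i assume i: "i \<in> I"
    have "(\<integral>\<omega>. (\<Sum>j\<in>I. (\<xi> i \<omega> * \<xi> j \<omega>) * (d i \<bullet> d j)) \<partial>P) = (\<Sum>j\<in>I. \<integral>\<omega>. (\<xi> i \<omega> * \<xi> j \<omega>) * (d i \<bullet> d j) \<partial>P)"
      by (intro Bochner_Integration.integral_sum int i)
    also have "\<dots> = (\<Sum>j\<in>I. (if i = j then 1 else 0) * (d i \<bullet> d j))"
      using i I by (intro sum.cong refl, subst integral_mult_left_zero, subst moments(2)) auto
    finally show "(\<integral>\<omega>. (\<Sum>j\<in>I. (\<xi> i \<omega> * \<xi> j \<omega>) * (d i \<bullet> d j)) \<partial>P) =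
      (\<Sum>j\<in>I. (if i = j then 1 else 0) * (d i \<bullet> d j))" .
  qed
  also have "\<dots> = (\<Sum>i\<in>I. (norm (d i))\<^sup>2)"
  proof (cases "finite I")
    case True
    then have "(\<Sum>j\<in>I. (if i = j then 1 else 0) * (d i \<bullet> d j)) = (norm (d i))\<^sup>2" if "i \<in> I" for i
      using that by (simp add: if_distrib[of "\<lambda>x. x * _"] power2_norm_eq_inner cong: if_cong)
    then show ?thesis by simp
  qed simp
  finally show "(sq_norm P (\<lambda>\<omega>. \<Sum>j\<in>I. \<xi> j \<omega> *\<^sub>R d j))\<^sup>2 = (\<Sum>j\<in>I. (norm (d j))\<^sup>2)"
    by (simp add: sq_norm_squared)
qed

lemma field_partial_sum_eq_noise_sum:
  "field_partial_sum \<gamma> lam e \<xi> n = (\<lambda>\<omega>. \<Sum>j\<in>{1..n}. \<xi> j \<omega> *\<^sub>R (\<gamma> (lam j) *\<^sub>R e j))"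
  unfolding field_partial_sum_def by (simp add: mult.commute)

text \<open>The field is known only as a limit in mean square of its partial sums. Hence the tail is
  computed between two partial sums, uniformly in the later one, and \<open>n\<close> is sent to infinity.\<close>

lemma field_truncation_error:
  fixes e :: "nat \<Rightarrow> 'h::{real_inner, banach, second_countable_topology}"
  assumes P: "prob_space P" and indep: "prob_space.indep_vars P (\<lambda>_. borel) \<xi> {1..}"
    and normal: "\<And>j. 1 \<le> j \<Longrightarrow> distributed P lborel (\<xi> j) std_normal_density"
    and orth: "orthonormal_family {1..} e"
    and field: "is_generalized_field P \<gamma> lam e \<xi> Z"
    and tail: "\<And>n. N \<le> n \<Longrightarrow> (\<Sum>j=N+1..n. (\<gamma> (lam j))\<^sup>2) \<le> T"
  shows "(sq_norm P (\<lambda>\<omega>. Z \<omega> - field_partial_sum \<gamma> lam e \<xi> N \<omega>))\<^sup>2 \<le> 2 * T"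
proof -
  let ?S = "field_partial_sum \<gamma> lam e \<xi>"
  let ?err = "\<lambda>n. sq_norm P (\<lambda>\<omega>. Z \<omega> - ?S n \<omega>)"
  have Z: "Z \<in> sq_integrable P" and S: "\<And>n. ?S n \<in> sq_integrable P" and lim: "?err \<longlonglongrightarrow> 0"
    using field by (auto simp: is_generalized_field_def)
  have norm_e: "norm (e j) = 1" if "1 \<le> j" for j
    using orth that by (auto simp: orthonormal_family_def norm_eq_sqrt_inner)
  have "(?err N)\<^sup>2 \<le> 2 * (?err n)\<^sup>2 + 2 * T" if "N \<le> n" for n
  proof -
    have split: "{1..n} = {1..N} \<union> {N+1..n}" "{1..N} \<inter> {N+1..n} = {}"
      using that by auto
    have diff: "?S n \<omega> - ?S N \<omega> = (\<Sum>j\<in>{N+1..n}. \<xi> j \<omega> *\<^sub>R (\<gamma> (lam j) *\<^sub>R e j))" for \<omega>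
      unfolding field_partial_sum_eq_noise_sum split(1)
      by (subst sum.union_disjoint) (use split(2) in auto)
    have "(sq_norm P (\<lambda>\<omega>. ?S n \<omega> - ?S N \<omega>))\<^sup>2 = (\<Sum>j\<in>{N+1..n}. (norm (\<gamma> (lam j) *\<^sub>R e j))\<^sup>2)"
      unfolding diff by (rule sq_norm_noise_sum(2)[OF P indep]) (use normal in auto)
    also have "\<dots> = (\<Sum>j=N+1..n. (\<gamma> (lam j))\<^sup>2)"
      using norm_e by (intro sum.cong) auto
    also have "\<dots> \<le> T" by (rule tail[OF that])
    finally have le_T: "(sq_norm P (\<lambda>\<omega>. ?S n \<omega> - ?S N \<omega>))\<^sup>2 \<le> T" .
    have "(?err N)\<^sup>2 \<le> 2 * (?err n)\<^sup>2 + 2 * (sq_norm P (\<lambda>\<omega>. ?S n \<omega> - ?S N \<omega>))\<^sup>2"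
      using sq_integrable_add(2)[OF sq_integrable_diff[OF Z S[of n]] sq_integrable_diff[OF S[of n] S[of N]]]
      by simp
    with le_T show ?thesis by simp
  qed
  moreover have "(\<lambda>n. 2 * (?err n)\<^sup>2 + 2 * T) \<longlonglongrightarrow> 2 * 0\<^sup>2 + 2 * T"
    by (intro tendsto_intros lim)
  ultimately show ?thesis
    by (intro LIMSEQ_le_const[of _ "2 * T"]) auto
qed

section \<open>Sums of powers\<close>

text \<open>By the mean value theorem, since \<open>z powr (t - 1)\<close> decreases in \<open>z\<close>. Summation telescopes:
  \<open>0 < t\<close> gives the growth of partial sums, \<open>t < 0\<close> the decay of tails.\<close>

lemma powr_le_increment:
  fixes x t :: real
  assumes x: "1 < x" and t: "t \<le> 1" "t \<noteq> 0"
  shows "x powr (t - 1) \<le> (x powr t - (x - 1) powr t) / t"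
proof -
  have "\<exists>z. x - 1 < z \<and> z < x \<and> x powr t - (x - 1) powr t = (x - (x - 1)) * (t * z powr (t - 1))"
    using x by (intro MVT2 has_real_derivative_powr) auto
  then obtain z where z: "x - 1 < z" "z < x" "x powr t - (x - 1) powr t = t * z powr (t - 1)"
    by auto
  then have "x powr (t - 1) \<le> z powr (t - 1)"
    using x t by (intro powr_mono2') auto
  with z t show ?thesis by simp
qed

lemma sum_powr_le:
  fixes t :: real
  assumes "0 < t"
  shows "(\<Sum>j=1..N. real j powr (t - 1)) \<le> (1 + 1 / t) * real N powr t"
proof (cases "t \<le> 1")
  case True
  have increments: "(\<Sum>j=1..n. real j powr (t - 1)) \<le> 1 - 1 / t + real n powr t / t" if "1 \<le> n" for n
    using that
  proof (induction n rule: dec_induct)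
    case (step n)
    have "real (Suc n) powr (t - 1) \<le> (real (Suc n) powr t - real n powr t) / t"
      using powr_le_increment[of "real (Suc n)" t] True assms step by simp
    with step.IH show ?case by (simp add: diff_divide_distrib)
  qed simp
  have "1 - 1 / t \<le> 0"
    using True assms by simp
  with increments[of N] have "(\<Sum>j=1..N. real j powr (t - 1)) \<le> real N powr t / t"
    using assms by (cases "1 \<le> N") (linarith, simp)
  also have "\<dots> \<le> (1 + 1 / t) * real N powr t"
    by (simp add: algebra_simps)
  finally show ?thesis .
next
  case False
  have "(\<Sum>j=1..N. real j powr (t - 1)) \<le> (\<Sum>j=1..N. real N powr (t - 1))"
    using False by (intro sum_mono powr_mono2) auto
  also have "\<dots> = real N powr t"
    by (cases "N = 0") (simp_all add: powr_diff)
  also have "\<dots> \<le> (1 + 1 / t) * real N powr t"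
    using assms by (simp add: algebra_simps)
  finally show ?thesis .
qed

lemma sum_powr_tail_le:
  fixes p :: real
  assumes "0 < p" "1 \<le> N" "N \<le> n"
  shows "(\<Sum>j=N+1..n. real j powr (- p - 1)) \<le> real N powr (- p) / p"
proof -
  have "(\<Sum>j=N+1..n. real j powr (- p - 1)) \<le> real N powr (- p) / p - real n powr (- p) / p"
    using \<open>N \<le> n\<close>
  proof (induction n rule: dec_induct)
    case (step n)
    have "real (Suc n) powr (- p - 1) \<le> (real (Suc n) powr (- p) - real n powr (- p)) / (- p)"
      using powr_le_increment[of "real (Suc n)" "- p"] assms step by simp
    also have "\<dots> = real n powr (- p) / p - real (Suc n) powr (- p) / p"
      using assms by (simp add: field_simps)
    finally show ?case using step by simp
  qed simp
  also have "\<dots> \<le> real N powr (- p) / p"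
    using assms by simp
  finally show ?thesis .
qed

section \<open>Deterministic error bounds\<close>

lemma sum_le_infsum_from_one:
  fixes g :: "nat \<Rightarrow> real"
  assumes "(\<lambda>j. (g j)\<^sup>2) summable_on {1..}" "finite I" "I \<subseteq> {1..}"
  shows "(\<Sum>j\<in>I. (g j)\<^sup>2) \<le> infsum (\<lambda>j. (g j)\<^sup>2) {1..}"
  using assms by (intro finite_sum_le_infsum) auto

text \<open>Finitely many exceptions to a bound by a positive weight only enlarge the constant.\<close>

lemma eventually_le_imp_le_mult:
  fixes g w :: "nat \<Rightarrow> real"
  assumes ev: "eventually (\<lambda>j. g j \<le> C * w j) sequentially"
    and w: "\<And>j. 1 \<le> j \<Longrightarrow> 0 < w j"
  obtains K where "0 < K" "\<And>j. 1 \<le> j \<Longrightarrow> g j \<le> K * w j"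
proof -
  obtain n where n: "\<And>j. n \<le> j \<Longrightarrow> g j \<le> C * w j"
    using ev by (auto simp: eventually_sequentially)
  \<comment> \<open>Each of the exceptional quotients \<open>\<bar>g j\<bar> / w j\<close> is at most the sum of all of them.\<close>
  define K where "K = 1 + \<bar>C\<bar> + (\<Sum>j=1..n. \<bar>g j\<bar> / w j)"
  have nonneg: "0 \<le> (\<Sum>j=1..n. \<bar>g j\<bar> / w j)"
    using w by (intro sum_nonneg) (auto simp: less_imp_le)
  have "g j \<le> K * w j" if j: "1 \<le> j" for j
  proof (cases "n \<le> j")
    case True
    have "C \<le> K" using nonneg by (simp add: K_def)
    with n[OF True] w[OF j] show ?thesis
      by (meson mult_right_mono less_imp_le order_trans)
  next
    case False
    have "\<bar>g j\<bar> / w j \<le> (\<Sum>j=1..n. \<bar>g j\<bar> / w j)"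
      using False j w by (intro member_le_sum) (auto simp: less_imp_le)
    also have "\<dots> \<le> K" by (simp add: K_def)
    finally show ?thesis
      using w[OF j] by (simp add: field_simps)
  qed
  moreover have "0 < K" using nonneg by (simp add: K_def)
  ultimately show thesis by (rule that[rotated])
qed

text \<open>For large \<open>j\<close> the eigenvalue exceeds \<open>R\<close> and is at least \<open>c * j powr \<alpha>\<close>, so that
  \<open>(\<gamma> (lam j))\<^sup>2\<close> is at most of order \<open>j powr (- 2 * \<alpha> * \<beta>)\<close>. The remaining indices, among them those of
  zero eigenvalues, are finite in number and go into the constant \<open>K\<close>; hence the estimate starts
  at \<open>N = 1\<close>.\<close>

lemma gamma_tail_bound:
  fixes lam :: "nat \<Rightarrow> real"
  assumes summable: "(\<lambda>j. (\<gamma> (lam j))\<^sup>2) summable_on {1..}"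
    and lim: "filterlim lam at_top sequentially"
    and growth: "0 < c" "\<And>j. 1 \<le> j \<Longrightarrow> 0 < lam j \<Longrightarrow> c * real j powr \<alpha> \<le> lam j"
    and decay: "0 < \<beta>" "\<And>x. R \<le> x \<Longrightarrow> \<bar>\<gamma> x\<bar> \<le> C * x powr (- \<beta>)"
    and p: "p = 2 * \<alpha> * \<beta> - 1" "0 \<le> p"
  obtains K where "0 \<le> K"
    "\<And>N n. 1 \<le> N \<Longrightarrow> N \<le> n \<Longrightarrow> (\<Sum>j=N+1..n. (\<gamma> (lam j))\<^sup>2) \<le> K * real N powr (- p)"
proof (cases "p = 0")
  case True
  \<comment> \<open>Here the power bound is of order \<open>1 / j\<close>, which is not summable. But the rate is \<open>0\<close>, so
    the convergence of the whole series is enough.\<close>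
  show thesis
  proof (rule that[of "infsum (\<lambda>j. (\<gamma> (lam j))\<^sup>2) {1..}"])
    show "0 \<le> infsum (\<lambda>j. (\<gamma> (lam j))\<^sup>2) {1..}" by (intro infsum_nonneg) simp
    fix N n :: nat assume "1 \<le> N" "N \<le> n"
    then show "(\<Sum>j=N+1..n. (\<gamma> (lam j))\<^sup>2) \<le> infsum (\<lambda>j. (\<gamma> (lam j))\<^sup>2) {1..} * real N powr (- p)"
      using True sum_le_infsum_from_one[OF summable, of "{N+1..n}"] by auto
  qed
next
  case False
  have ev: "eventually (\<lambda>j. (\<gamma> (lam j))\<^sup>2 \<le> (C\<^sup>2 * c powr (- 2 * \<beta>)) * real j powr (- p - 1)) sequentially"
  proof -
    have "eventually (\<lambda>j. max R 1 \<le> lam j) sequentially"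
      using lim unfolding filterlim_at_top by blast
    then show ?thesis
      using eventually_ge_at_top[of 1]
    proof eventually_elim
      case (elim j)
      have "(\<gamma> (lam j))\<^sup>2 \<le> (C * lam j powr (- \<beta>))\<^sup>2"
        using decay(2)[of "lam j"] elim power_mono[of "\<bar>\<gamma> (lam j)\<bar>" _ 2] by simp
      also have "\<dots> = C\<^sup>2 * lam j powr (- 2 * \<beta>)"
        using elim by (simp add: power_mult_distrib powr_power)
      also have "\<dots> \<le> C\<^sup>2 * (c * real j powr \<alpha>) powr (- 2 * \<beta>)"
        using elim growth decay by (intro mult_left_mono powr_mono2') auto
      also have "\<dots> = (C\<^sup>2 * c powr (- 2 * \<beta>)) * real j powr (- p - 1)"
        using growth p elim by (simp add: powr_mult powr_powr mult_ac)
      finally show ?case .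
    qed
  qed
  obtain K where K: "0 < K" "\<And>j. 1 \<le> j \<Longrightarrow> (\<gamma> (lam j))\<^sup>2 \<le> K * real j powr (- p - 1)"
    by (rule eventually_le_imp_le_mult[OF ev]) auto
  show thesis
  proof (rule that[of "K / p"])
    show "0 \<le> K / p" using K p by simp
    fix N n :: nat assume N: "1 \<le> N" "N \<le> n"
    have "(\<Sum>j=N+1..n. (\<gamma> (lam j))\<^sup>2) \<le> K * (\<Sum>j=N+1..n. real j powr (- p - 1))"
      unfolding sum_distrib_left using N by (intro sum_mono K) auto
    also have "\<dots> \<le> K * (real N powr (- p) / p)"
      using K N p False by (intro mult_left_mono sum_powr_tail_le) auto
    finally show "(\<Sum>j=N+1..n. (\<gamma> (lam j))\<^sup>2) \<le> K / p * real N powr (- p)" by simp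
  qed
qed

lemma derivative_bound_increment:
  fixes \<gamma> :: "real \<Rightarrow> real"
  assumes diff: "\<gamma> differentiable_on {0..}" and a: "0 \<le> a" and C: "0 \<le> C"
    and deriv: "\<And>x. 0 < x \<Longrightarrow> \<bar>deriv \<gamma> x\<bar> \<le> C * x powr (- a)"
    and xy: "0 < x" "x \<le> y"
  shows "\<bar>\<gamma> x - \<gamma> y\<bar> \<le> C * x powr (- a) * (y - x)"
proof (cases "x = y")
  case False
  have "DERIV \<gamma> z :> deriv \<gamma> z" if "x \<le> z" for z
  proof -
    have "\<gamma> differentiable at z within {0..}"
      using diff that xy by (auto simp: differentiable_on_def)
    moreover have "at z within {0..} = at z"
      by (rule at_within_interior) (use that xy in auto)
    ultimately show ?thesis
      using DERIV_deriv_iff_real_differentiable by metis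
  qed
  then have "\<exists>z. x < z \<and> z < y \<and> \<gamma> y - \<gamma> x = (y - x) * deriv \<gamma> z"
    using False xy by (intro MVT2) auto
  then obtain z where z: "x < z" "z < y" "\<gamma> y - \<gamma> x = (y - x) * deriv \<gamma> z"
    by blast
  have "\<bar>deriv \<gamma> z\<bar> \<le> C * z powr (- a)" using deriv z xy by simp
  also have "\<dots> \<le> C * x powr (- a)"
    using z xy a C by (intro mult_left_mono powr_mono2') auto
  finally have "(y - x) * \<bar>deriv \<gamma> z\<bar> \<le> (y - x) * (C * x powr (- a))"
    using xy by (intro mult_left_mono) auto
  moreover have "\<bar>\<gamma> x - \<gamma> y\<bar> = (y - x) * \<bar>deriv \<gamma> z\<bar>"
    using z(3) xy by (metis abs_minus_commute abs_mult abs_of_nonneg diff_ge_0_iff_ge)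
  ultimately show ?thesis by (simp add: mult_ac)
qed simp

lemma powr_between_le:
  fixes x y c C t :: real
  assumes "0 < c" "0 < C" "0 < y" "c * y \<le> x" "x \<le> C * y"
  shows "x powr t \<le> (c powr t + C powr t) * y powr t"
proof (cases "0 \<le> t")
  case True
  have "0 < c * y" using assms by simp
  then have "x powr t \<le> (C * y) powr t"
    using assms True by (intro powr_mono2) linarith+
  also have "\<dots> = C powr t * y powr t" using assms by (simp add: powr_mult)
  finally show ?thesis by (simp add: distrib_right add_increasing)
next
  case False
  have "x powr t \<le> (c * y) powr t"
    using assms False by (intro powr_mono2') auto
  also have "\<dots> = c powr t * y powr t" using assms by (simp add: powr_mult)
  finally show ?thesis by (simp add: distrib_right add_increasing2)
qed

text \<open>By the bound on the derivative of \<open>\<gamma>\<close>, the error at \<open>j\<close> is at most of order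
  \<open>\<delta> * lam j powr (q - a)\<close>, and thus its square of order \<open>\<delta>\<^sup>2 * j powr (2 * \<alpha> * q - 2 * \<alpha> * a)\<close>.
  As \<open>1 \<le> 2 * \<alpha> * a\<close>, the derivative gains a factor \<open>1 / j\<close>, and summing
  \<open>j powr (2 * \<alpha> * q - 1)\<close> costs no more than \<open>N powr (2 * \<alpha> * q)\<close>. A zero eigenvalue, at which the
  derivative bound would be void, is reproduced exactly because its allowed error is a multiple of
  \<open>0 powr q = 0\<close>.

  The sign of \<open>q - a\<close> is not determined. This is why both growth constants enter: the lower one
  controls negative powers of the eigenvalue, the upper one positive powers.\<close>

lemma eigenvalue_error_sum:
  fixes lam lam' :: "nat \<Rightarrow> real"
  assumes growth: "0 < c" "0 < C"
      "\<And>j. 1 \<le> j \<Longrightarrow> 0 < lam j \<Longrightarrow> c * real j powr \<alpha> \<le> lam j \<and> lam j \<le> C * real j powr \<alpha>"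
    and nonneg: "\<And>j. 1 \<le> j \<Longrightarrow> 0 \<le> lam j"
    and gamma: "\<gamma> differentiable_on {0..}" "0 \<le> a" "0 \<le> D"
      "\<And>x. 0 < x \<Longrightarrow> \<bar>deriv \<gamma> x\<bar> \<le> D * x powr (- a)"
    and error: "0 \<le> \<delta>"
      "\<And>j. j \<in> {1..N} \<Longrightarrow> 0 \<le> lam' j - lam j \<and> lam' j - lam j \<le> \<delta> * lam j powr q"
    and exponents: "0 < \<alpha>" "0 < q" "1 / 2 \<le> \<alpha> * a"
  shows "(\<Sum>j=1..N. (\<gamma> (lam j) - \<gamma> (lam' j))\<^sup>2)
    \<le> D\<^sup>2 * (c powr (2 * (q - a)) + C powr (2 * (q - a))) * (1 + 1 / (2 * \<alpha> * q)) *
       (\<delta>\<^sup>2 * real N powr (2 * \<alpha> * q))"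
proof -
  let ?B = "c powr (2 * (q - a)) + C powr (2 * (q - a))"
  have "(\<gamma> (lam j) - \<gamma> (lam' j))\<^sup>2 \<le> D\<^sup>2 * \<delta>\<^sup>2 * ?B * real j powr (2 * \<alpha> * q - 1)"
    if j: "j \<in> {1..N}" for j
  proof (cases "lam j = 0")
    case True
    then have "lam' j = lam j" using error(2)[OF j] by simp
    then show ?thesis by simp
  next
    case False
    then have pos: "0 < lam j" using nonneg[of j] j by simp
    have "\<bar>\<gamma> (lam j) - \<gamma> (lam' j)\<bar> \<le> D * lam j powr (- a) * (lam' j - lam j)"
      using error(2)[OF j] pos by (intro derivative_bound_increment gamma) auto
    also have "\<dots> \<le> D * lam j powr (- a) * (\<delta> * lam j powr q)"
      using error(2)[OF j] gamma by (intro mult_left_mono) auto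
    also have "\<dots> = D * \<delta> * lam j powr (q - a)"
      by (simp add: powr_diff powr_minus divide_inverse)
    finally have "\<bar>\<gamma> (lam j) - \<gamma> (lam' j)\<bar>\<^sup>2 \<le> (D * \<delta> * lam j powr (q - a))\<^sup>2"
      by (intro power_mono) auto
    then have "(\<gamma> (lam j) - \<gamma> (lam' j))\<^sup>2 \<le> D\<^sup>2 * \<delta>\<^sup>2 * lam j powr (2 * (q - a))"
      using pos by (simp add: power_mult_distrib powr_power mult.commute)
    also have "\<dots> \<le> D\<^sup>2 * \<delta>\<^sup>2 * (?B * (real j powr \<alpha>) powr (2 * (q - a)))"
      using growth pos j by (intro mult_left_mono powr_between_le) auto
    also have "\<dots> = D\<^sup>2 * \<delta>\<^sup>2 * ?B * real j powr (2 * \<alpha> * q - 2 * (\<alpha> * a))"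
      by (simp add: powr_powr algebra_simps)
    also have "\<dots> \<le> D\<^sup>2 * \<delta>\<^sup>2 * ?B * real j powr (2 * \<alpha> * q - 1)"
      using exponents j by (intro mult_left_mono powr_mono) auto
    finally show ?thesis .
  qed
  then have "(\<Sum>j=1..N. (\<gamma> (lam j) - \<gamma> (lam' j))\<^sup>2)
      \<le> D\<^sup>2 * \<delta>\<^sup>2 * ?B * (\<Sum>j=1..N. real j powr (2 * \<alpha> * q - 1))"
    unfolding sum_distrib_left by (rule sum_mono)
  also have "\<dots> \<le> D\<^sup>2 * \<delta>\<^sup>2 * ?B * ((1 + 1 / (2 * \<alpha> * q)) * real N powr (2 * \<alpha> * q))"
    using exponents by (intro mult_left_mono sum_powr_le) auto
  finally show ?thesis by (simp add: mult_ac)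
qed

text \<open>Each squared distance of eigenvectors is at most the largest allowed one, whose order does not exceed
  \<open>\<delta> * N powr (\<alpha> * q)\<close>; the weights \<open>(\<gamma> (lam j))\<^sup>2\<close> have a finite total.\<close>

lemma eigenvector_error_sum:
  fixes lam :: "nat \<Rightarrow> real" and e e' :: "nat \<Rightarrow> 'h::real_normed_vector"
  assumes summable: "(\<lambda>j. (\<gamma> (lam j))\<^sup>2) summable_on {1..}"
    and growth: "0 < \<alpha>" "0 < C" "\<And>j. 1 \<le> j \<Longrightarrow> 0 < lam j \<Longrightarrow> lam j \<le> C * real j powr \<alpha>"
    and nonneg: "\<And>j. 1 \<le> j \<Longrightarrow> 0 \<le> lam j"
    and error: "0 \<le> \<delta>" "\<And>j. j \<in> {1..N} \<Longrightarrow> (norm (e' j - e j))\<^sup>2 \<le> \<delta> * lam j powr q"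
    and q: "0 < q"
  shows "(\<Sum>j=1..N. (\<gamma> (lam j))\<^sup>2 * (norm (e j - e' j))\<^sup>2)
    \<le> C powr q * infsum (\<lambda>j. (\<gamma> (lam j))\<^sup>2) {1..} * (\<delta> * real N powr (\<alpha> * q))"
proof -
  have bound: "(norm (e j - e' j))\<^sup>2 \<le> \<delta> * (C powr q * real N powr (\<alpha> * q))" if j: "j \<in> {1..N}" for j
  proof -
    have "lam j \<le> C * real N powr \<alpha>"
    proof (cases "lam j = 0")
      case False
      then have "lam j \<le> C * real j powr \<alpha>" using growth(3)[of j] nonneg[of j] j by simp
      also have "\<dots> \<le> C * real N powr \<alpha>"
        using growth j by (intro mult_left_mono powr_mono2) auto
      finally show ?thesis .
    qed (use growth in simp)
    then have "lam j powr q \<le> (C * real N powr \<alpha>) powr q"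
      using nonneg[of j] j q by (intro powr_mono2) auto
    also have "\<dots> = C powr q * real N powr (\<alpha> * q)"
      using growth by (simp add: powr_mult powr_powr)
    finally have "\<delta> * lam j powr q \<le> \<delta> * (C powr q * real N powr (\<alpha> * q))"
      using error by (intro mult_left_mono)
    with error(2)[OF j] show ?thesis by (simp add: norm_minus_commute)
  qed
  have "(\<Sum>j=1..N. (\<gamma> (lam j))\<^sup>2 * (norm (e j - e' j))\<^sup>2)
      \<le> (\<Sum>j=1..N. (\<gamma> (lam j))\<^sup>2) * (\<delta> * (C powr q * real N powr (\<alpha> * q)))"
    unfolding sum_distrib_right by (intro sum_mono mult_left_mono bound) auto
  also have "\<dots> \<le> infsum (\<lambda>j. (\<gamma> (lam j))\<^sup>2) {1..} * (\<delta> * (C powr q * real N powr (\<alpha> * q)))"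
    using error by (intro mult_right_mono sum_le_infsum_from_one summable) auto
  finally show ?thesis by (simp add: mult_ac)
qed

section \<open>The error of one discretisation\<close>

text \<open>The comparison passes through \<open>\<Sum>j\<le>N. \<gamma> (lam j) * \<xi> j *\<^sub>R e' j\<close>, with exact eigenvalues but
  approximate eigenvectors. In this order the distances \<open>norm (e j - e' j)\<close> are weighted by the exact
  \<open>\<gamma> (lam j)\<close>, which are square summable uniformly in \<open>N\<close>, and the differences of \<open>\<gamma>\<close> are
  multiplied by unit vectors.\<close>

lemma field_discretisation_error:
  fixes e :: "nat \<Rightarrow> 'h::{real_inner, banach, second_countable_topology}"
  assumes P: "prob_space P" and indep: "prob_space.indep_vars P (\<lambda>_. borel) \<xi> {1..}"
    and normal: "\<And>j. 1 \<le> j \<Longrightarrow> distributed P lborel (\<xi> j) std_normal_density"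
    and orth: "orthonormal_family {1..} e" and orth': "orthonormal_family {1..N} e'"
    and field: "is_generalized_field P \<gamma> lam e \<xi> Z"
    and tail: "\<And>n. N \<le> n \<Longrightarrow> (\<Sum>j=N+1..n. (\<gamma> (lam j))\<^sup>2) \<le> T"
  shows "(\<lambda>\<omega>. Z \<omega> - field_partial_sum \<gamma> lam' e' \<xi> N \<omega>) \<in> sq_integrable P"
    and "(sq_norm P (\<lambda>\<omega>. Z \<omega> - field_partial_sum \<gamma> lam' e' \<xi> N \<omega>))\<^sup>2
      \<le> 4 * T + 4 * (\<Sum>j=1..N. (\<gamma> (lam j))\<^sup>2 * (norm (e j - e' j))\<^sup>2)
        + 4 * (\<Sum>j=1..N. (\<gamma> (lam j) - \<gamma> (lam' j))\<^sup>2)"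
proof -
  let ?S = "field_partial_sum \<gamma> lam e \<xi> N" and ?S' = "field_partial_sum \<gamma> lam' e' \<xi> N"
  define d where "d j = \<gamma> (lam j) *\<^sub>R e j - \<gamma> (lam' j) *\<^sub>R e' j" for j
  have Z: "Z \<in> sq_integrable P" and S: "?S \<in> sq_integrable P"
    using field by (auto simp: is_generalized_field_def)
  have diff: "?S \<omega> - ?S' \<omega> = (\<Sum>j\<in>{1..N}. \<xi> j \<omega> *\<^sub>R d j)" for \<omega>
    unfolding field_partial_sum_eq_noise_sum d_def by (simp add: scaleR_diff_right sum_subtractf)
  note noise = sq_norm_noise_sum[OF P indep, of "{1..N}" d]
  have SS': "(\<lambda>\<omega>. ?S \<omega> - ?S' \<omega>) \<in> sq_integrable P"
    unfolding diff using normal by (intro noise(1)) auto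
  note ZS = sq_integrable_diff[OF Z S]
  show "(\<lambda>\<omega>. Z \<omega> - ?S' \<omega>) \<in> sq_integrable P"
    using sq_integrable_add(1)[OF ZS SS'] by simp
  have d_le: "(norm (d j))\<^sup>2 \<le> 2 * ((\<gamma> (lam j))\<^sup>2 * (norm (e j - e' j))\<^sup>2) + 2 * (\<gamma> (lam j) - \<gamma> (lam' j))\<^sup>2"
    if j: "j \<in> {1..N}" for j
  proof -
    have "norm (e' j) = 1"
      using orth' j by (auto simp: orthonormal_family_def norm_eq_sqrt_inner)
    moreover have "d j = \<gamma> (lam j) *\<^sub>R (e j - e' j) + (\<gamma> (lam j) - \<gamma> (lam' j)) *\<^sub>R e' j"
      by (simp add: d_def algebra_simps)
    ultimately show ?thesis
      using norm_add_squared_le[of "\<gamma> (lam j) *\<^sub>R (e j - e' j)" "(\<gamma> (lam j) - \<gamma> (lam' j)) *\<^sub>R e' j"]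
      by (simp add: power_mult_distrib)
  qed
  have "(sq_norm P (\<lambda>\<omega>. ?S \<omega> - ?S' \<omega>))\<^sup>2 = (\<Sum>j=1..N. (norm (d j))\<^sup>2)"
    unfolding diff using normal by (intro noise(2)) auto
  also have "\<dots> \<le> (\<Sum>j=1..N. 2 * ((\<gamma> (lam j))\<^sup>2 * (norm (e j - e' j))\<^sup>2) + 2 * (\<gamma> (lam j) - \<gamma> (lam' j))\<^sup>2)"
    by (intro sum_mono d_le)
  also have "\<dots> = 2 * (\<Sum>j=1..N. (\<gamma> (lam j))\<^sup>2 * (norm (e j - e' j))\<^sup>2)
        + 2 * (\<Sum>j=1..N. (\<gamma> (lam j) - \<gamma> (lam' j))\<^sup>2)"
    by (simp add: sum.distrib sum_distrib_left)
  finally have spectral: "(sq_norm P (\<lambda>\<omega>. ?S \<omega> - ?S' \<omega>))\<^sup>2 \<le> \<dots>" .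
  have "(sq_norm P (\<lambda>\<omega>. Z \<omega> - ?S \<omega>))\<^sup>2 \<le> 2 * T"
    by (rule field_truncation_error[OF P indep normal orth field tail])
  then show "(sq_norm P (\<lambda>\<omega>. Z \<omega> - ?S' \<omega>))\<^sup>2
      \<le> 4 * T + 4 * (\<Sum>j=1..N. (\<gamma> (lam j))\<^sup>2 * (norm (e j - e' j))\<^sup>2)
        + 4 * (\<Sum>j=1..N. (\<gamma> (lam j) - \<gamma> (lam' j))\<^sup>2)"
    using spectral sq_integrable_add(2)[OF ZS SS'] by simp
qed

section \<open>Convergence rate\<close>

theorem theorem3p2:
  fixes L :: "'h::{real_inner, banach, second_countable_topology} \<Rightarrow> 'h"
    and domL :: "'h set"
    and lam :: "nat \<Rightarrow> real" and e :: "nat \<Rightarrow> 'h"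
    and \<H> :: "real set" and V :: "real \<Rightarrow> 'h set" and f :: "real \<Rightarrow> nat \<Rightarrow> 'h"
    and lamh :: "real \<Rightarrow> nat \<Rightarrow> real" and eh :: "real \<Rightarrow> nat \<Rightarrow> 'h"
    and \<gamma> :: "real \<Rightarrow> real"
    and P :: "'w measure" and \<xi> :: "nat \<Rightarrow> 'w \<Rightarrow> real" and Z :: "'w \<Rightarrow> 'h"
    and \<alpha> c\<^sub>L C\<^sub>L C\<^sub>D a \<beta> C\<^sub>G R\<^sub>G dt C\<^sub>F C\<^sub>1 C\<^sub>2 h\<^sub>0 r s q :: real
  assumes setting:
      "(\<exists>(D :: (real^'n::finite) set) cls. polygonal_domain_setting D cls domL L) \<or>
       (\<exists>(X :: 'p topology) (A :: ('p, 'n) chart set) G \<mu> cls. manifold_setting X A G \<mu> cls domL L)"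
    and self_adjoint: "self_adjoint_operator domL L"
    and positive: "positive_semidefinite_operator domL L"
    and basis: "hilbert_basis e"
    and eigen: "\<And>j. 1 \<le> j \<Longrightarrow> e j \<in> domL \<and> L (e j) = lam j *\<^sub>R e j"
    and eigenvalues: "0 \<le> lam 1" "mono_on {1..} lam" "filterlim lam at_top sequentially"
    and mesh_sizes: "\<H> \<subseteq> {0<..1}"
    and fe_space: "\<And>h. h \<in> \<H> \<Longrightarrow> subspace (V h) \<and> V h \<subseteq> domL"
    and fe_basis: "\<And>h. h \<in> \<H> \<Longrightarrow> orthonormal_basis_of (V h) (dim (V h)) (f h)"
    and eigenbasis_h: "\<And>h. h \<in> \<H> \<Longrightarrow> orthonormal_basis_of (V h) (dim (V h)) (eh h)"
    and eigen_h: "\<And>h j. h \<in> \<H> \<Longrightarrow> j \<in> {1..dim (V h)} \<Longrightarrow>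
       galerkin_operator (dim (V h)) (f h) L (eh h j) = lamh h j *\<^sub>R eh h j"
    and eigenvalues_h: "\<And>h. h \<in> \<H> \<Longrightarrow> mono_on {1..dim (V h)} (lamh h)"
       "\<And>h j. h \<in> \<H> \<Longrightarrow> j \<in> {1..dim (V h)} \<Longrightarrow> 0 \<le> lamh h j"
    and probability: "prob_space P" "complete_measure P"
    and noise_indep: "prob_space.indep_vars P (\<lambda>_. borel) \<xi> {1..}"
    and noise_normal: "\<And>j. 1 \<le> j \<Longrightarrow> distributed P lborel (\<xi> j) std_normal_density"
    and gamma_summable: "(\<lambda>j. (\<gamma> (lam j))\<^sup>2) summable_on {1..}"
    and field: "is_generalized_field P \<gamma> lam e \<xi> Z"
    and assumption1: "0 < \<alpha>" "0 < c\<^sub>L" "0 < C\<^sub>L"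
       "\<And>j. 1 \<le> j \<Longrightarrow> 0 < lam j \<Longrightarrow>
          c\<^sub>L * real j powr \<alpha> \<le> lam j \<and> lam j \<le> C\<^sub>L * real j powr \<alpha>"
    and assumption2: "\<gamma> differentiable_on {0..}" "0 < C\<^sub>D" "0 \<le> a"
       "\<And>x. 0 < x \<Longrightarrow> \<bar>deriv \<gamma> x\<bar> \<le> C\<^sub>D * x powr (- a)"
    and assumption3: "0 < \<beta>" "0 < C\<^sub>G" "0 < R\<^sub>G"
       "\<And>x. R\<^sub>G \<le> x \<Longrightarrow> \<bar>\<gamma> x\<bar> \<le> C\<^sub>G * x powr (- \<beta>)"
    and assumption4: "0 < dt" "0 < C\<^sub>F"
       "\<And>h. h \<in> \<H> \<Longrightarrow> real (dim (V h)) = C\<^sub>F * h powr (- dt)"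
    and assumption6: "0 < C\<^sub>1" "0 < C\<^sub>2" "0 < h\<^sub>0" "h\<^sub>0 < 1" "0 < r" "0 < s" "1 < q"
       "\<And>h j. h \<in> \<H> \<inter> {0<..<h\<^sub>0} \<Longrightarrow> j \<in> {1..dim (V h)} \<Longrightarrow>
          0 \<le> lamh h j - lam j \<and> lamh h j - lam j \<le> C\<^sub>1 * h powr r * lam j powr q"
       "\<And>h j. h \<in> \<H> \<inter> {0<..<h\<^sub>0} \<Longrightarrow> j \<in> {1..dim (V h)} \<Longrightarrow>
          (norm (eh h j - e j))\<^sup>2 \<le> C\<^sub>2 * h powr (2 * s) * lam j powr q"
    and growth_exponent:
       "max (ereal (1 / (2 * \<beta>))) (if a = 0 then \<infinity> else ereal (1 / (2 * a))) \<le> ereal \<alpha>"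
       "\<alpha> \<le> min (2 * s / (dt * q)) (r / (dt * q))"
  shows "\<exists>M. \<forall>h \<in> \<H> \<inter> {0<..<h\<^sub>0}.
     h \<le> (1 / C\<^sub>F * real_of_int \<lceil>(R\<^sub>G / c\<^sub>L) powr (1 / \<alpha>)\<rceil>) powr (- 1 / dt) \<longrightarrow>
     (let Zh = field_partial_sum \<gamma> (lamh h) (eh h) \<xi> (dim (V h)) in
       (\<lambda>\<omega>. Z \<omega> - Zh \<omega>) \<in> sq_integrable P \<and>
       sq_norm P (\<lambda>\<omega>. Z \<omega> - Zh \<omega>)
         \<le> M * h powr Min {s - dt * q * \<alpha> / 2, r - dt * q * \<alpha>,
                           dt * (\<alpha> * \<beta> - 1 / 2), dt * (\<alpha> * a - 1 / 2)})"
proof -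
  define G where "G = infsum (\<lambda>j. (\<gamma> (lam j))\<^sup>2) {1..}"
  define p where "p = 2 * \<alpha> * \<beta> - 1"
  define m where "m = Min {s - dt * q * \<alpha> / 2, r - dt * q * \<alpha>,
                           dt * (\<alpha> * \<beta> - 1 / 2), dt * (\<alpha> * a - 1 / 2)}"
  have m: "m \<le> s - dt * q * \<alpha> / 2" "m \<le> r - dt * q * \<alpha>" "m \<le> dt * (\<alpha> * \<beta> - 1 / 2)"
    unfolding m_def by simp_all
  have orth: "orthonormal_family {1..} e"
    using basis by (simp add: hilbert_basis_def)
  have lam_nonneg: "0 \<le> lam j" if "1 \<le> j" for j
    using eigenvalues(1) mono_onD[OF eigenvalues(2), of 1 j] that by simp
  have a: "1 / 2 \<le> \<alpha> * a"
  proof (cases "a = 0")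
    \<comment> \<open>For \<open>a = 0\<close> the lower bound on \<open>\<alpha>\<close> is infinite, which is absurd.\<close>
    case False
    then have "1 / (2 * a) \<le> \<alpha>" using growth_exponent(1) by simp
    then show ?thesis using False assumption2(3) by (simp add: field_simps)
  qed (use growth_exponent(1) in simp)
  have "1 / (2 * \<beta>) \<le> \<alpha>" using growth_exponent(1) by simp
  then have p_nonneg: "0 \<le> p"
    using assumption3(1) by (simp add: p_def field_simps)
  obtain K where K: "0 \<le> K"
    "\<And>N n. 1 \<le> N \<Longrightarrow> N \<le> n \<Longrightarrow> (\<Sum>j=N+1..n. (\<gamma> (lam j))\<^sup>2) \<le> K * real N powr (- p)"
    using gamma_tail_bound[OF gamma_summable eigenvalues(3) assumption1(2) conjunct1[OF assumption1(4)]
        assumption3(1) assumption3(4) p_def p_nonneg] by blast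
  \<comment> \<open>The indices stand for truncation, eigenvectors and eigenvalues. Replacing \<open>N\<close> by
    \<open>C\<^sub>F * h powr (- dt)\<close> in the three error bounds produces these factors.\<close>
  define K\<^sub>T where "K\<^sub>T = K * C\<^sub>F powr (- p)"
  define K\<^sub>V where "K\<^sub>V = C\<^sub>L powr q * G * (C\<^sub>2 * C\<^sub>F powr (\<alpha> * q))"
  define K\<^sub>E where "K\<^sub>E = C\<^sub>D\<^sup>2 * (c\<^sub>L powr (2 * (q - a)) + C\<^sub>L powr (2 * (q - a))) * (1 + 1 / (2 * \<alpha> * q)) *
      (C\<^sub>1\<^sup>2 * C\<^sub>F powr (2 * \<alpha> * q))"
  have G: "0 \<le> G" unfolding G_def by (intro infsum_nonneg) simp
  have nonneg: "0 \<le> K\<^sub>T" "0 \<le> K\<^sub>V" "0 \<le> K\<^sub>E"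
    using K(1) G assumption1 assumption6 by (simp_all add: K\<^sub>T_def K\<^sub>V_def K\<^sub>E_def)
  have "(\<lambda>\<omega>. Z \<omega> - field_partial_sum \<gamma> (lamh h) (eh h) \<xi> (dim (V h)) \<omega>) \<in> sq_integrable P \<and>
      sq_norm P (\<lambda>\<omega>. Z \<omega> - field_partial_sum \<gamma> (lamh h) (eh h) \<xi> (dim (V h)) \<omega>)
        \<le> sqrt (4 * (K\<^sub>T + K\<^sub>V + K\<^sub>E)) * h powr m"
    if h: "h \<in> \<H> \<inter> {0<..<h\<^sub>0}" for h
  proof -
    let ?N = "dim (V h)" and ?err = "sq_norm P (\<lambda>\<omega>. Z \<omega> - field_partial_sum \<gamma> (lamh h) (eh h) \<xi> (dim (V h)) \<omega>)"
    have h01: "0 < h" "h \<le> 1" and hH: "h \<in> \<H>" using h mesh_sizes by auto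
    have N: "real ?N = C\<^sub>F * h powr (- dt)" by (rule assumption4(3)[OF hH])
    then have "0 < real ?N" using h01 assumption4 by simp
    then have N1: "1 \<le> ?N" by simp
    have N_powr: "real ?N powr t = C\<^sub>F powr t * h powr (- dt * t)" for t
      unfolding N using assumption4 by (simp add: powr_mult powr_powr)
    have rate: "h powr x \<le> h powr (2 * m)" if "2 * m \<le> x" for x
      using that h01 by (intro powr_mono') auto
    have orth_h: "orthonormal_family {1..?N} (eh h)"
      using eigenbasis_h[OF hH] by (simp add: orthonormal_basis_of_def)
    note discretisation = field_discretisation_error[where lam' = "lamh h", OF probability(1) noise_indep noise_normal
        orth orth_h field K(2)[OF N1]]
    have truncation: "K * real ?N powr (- p) \<le> K\<^sub>T * h powr (2 * m)"
    proof -
      have "K * real ?N powr (- p) = K\<^sub>T * h powr (dt * p)"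
        by (simp add: N_powr K\<^sub>T_def)
      also have "\<dots> \<le> K\<^sub>T * h powr (2 * m)"
        using m(3) nonneg by (intro mult_left_mono rate) (simp_all add: p_def algebra_simps)
      finally show ?thesis .
    qed
    have eigenvectors: "(\<Sum>j=1..?N. (\<gamma> (lam j))\<^sup>2 * (norm (e j - eh h j))\<^sup>2) \<le> K\<^sub>V * h powr (2 * m)"
    proof -
      have "(\<Sum>j=1..?N. (\<gamma> (lam j))\<^sup>2 * (norm (e j - eh h j))\<^sup>2)
          \<le> C\<^sub>L powr q * G * (C\<^sub>2 * h powr (2 * s) * real ?N powr (\<alpha> * q))"
        unfolding G_def using assumption1 assumption6 lam_nonneg h
        by (intro eigenvector_error_sum gamma_summable) auto
      also have "\<dots> = K\<^sub>V * (h powr (2 * s) * h powr (- dt * (\<alpha> * q)))"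
        by (simp add: N_powr K\<^sub>V_def)
      also have "\<dots> = K\<^sub>V * h powr (2 * s + - dt * (\<alpha> * q))"
        by (simp only: powr_add)
      also have "\<dots> \<le> K\<^sub>V * h powr (2 * m)"
        using m(1) nonneg by (intro mult_left_mono rate) (simp_all add: algebra_simps)
      finally show ?thesis .
    qed
    have eigenvalues: "(\<Sum>j=1..?N. (\<gamma> (lam j) - \<gamma> (lamh h j))\<^sup>2) \<le> K\<^sub>E * h powr (2 * m)"
    proof -
      have "(\<Sum>j=1..?N. (\<gamma> (lam j) - \<gamma> (lamh h j))\<^sup>2)
          \<le> C\<^sub>D\<^sup>2 * (c\<^sub>L powr (2 * (q - a)) + C\<^sub>L powr (2 * (q - a))) * (1 + 1 / (2 * \<alpha> * q)) *
             ((C\<^sub>1 * h powr r)\<^sup>2 * real ?N powr (2 * \<alpha> * q))"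
        using assumption1 assumption2 assumption6 lam_nonneg h a
        by (intro eigenvalue_error_sum) auto
      also have "\<dots> = K\<^sub>E * (h powr (2 * r) * h powr (- dt * (2 * \<alpha> * q)))"
        using h01 by (simp add: N_powr K\<^sub>E_def power_mult_distrib powr_power mult.commute)
      also have "\<dots> = K\<^sub>E * h powr (2 * r + - dt * (2 * \<alpha> * q))"
        by (simp only: powr_add)
      also have "\<dots> \<le> K\<^sub>E * h powr (2 * m)"
        using m(2) nonneg by (intro mult_left_mono rate) (simp_all add: algebra_simps)
      finally show ?thesis .
    qed
    have "?err\<^sup>2 \<le> 4 * (K\<^sub>T + K\<^sub>V + K\<^sub>E) * h powr (2 * m)"
      using discretisation(2) truncation eigenvectors eigenvalues by (simp add: algebra_simps)
    also have "\<dots> = (sqrt (4 * (K\<^sub>T + K\<^sub>V + K\<^sub>E)) * h powr m)\<^sup>2"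
      using nonneg h01 by (simp add: power_mult_distrib powr_power mult.commute)
    finally have "?err \<le> sqrt (4 * (K\<^sub>T + K\<^sub>V + K\<^sub>E)) * h powr m"
      using nonneg by (intro power2_le_imp_le[of ?err]) auto
    with discretisation(1) show ?thesis by simp
  qed
  then show ?thesis
    unfolding Let_def m_def by blast
qed

end
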